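(* The following deterministic online algorithm with advice for \textsc{MBM} is $\frac35$-competitive and uses $m$ advice bits. The oracle runs $\textsc{Ranking}(\sigma)$ on the input with $\sigma$ the identity ranking ($\sigma(b)=b$), obtaining a matching $M_G$, and sets $c(b)=1$ if $b\in B$ is not matched in $M_G$ and $c(b)=2$ otherwise; the function $c$ is given to the algorithm as $m$ advice bits. The algorithm then returns $\textsc{Ranking}(\sigma_c)$.
   Context: Online maximum bipartite matching (\textsc{MBM}): the input is a bipartite graph $G=(A,B,E)$ with $A=[n]$, $B=[m]$, $m=\Theta(n)$; the $A$-vertices, together with their incident edges, arrive one at a time in an adversarially chosen order, and upon arrival of $a\in A$ the algorithm must irrevocably match $a$ to a currently unmatched neighbour or leave it unmatched. In the advice (tape) model, an all-powerful oracle knowing the whole input (including the arrival order) writes an advice string beforehand that the algorithm may read. A deterministic algorithm is $\rho$-competitive if on every input its output matching $M$ satisfies $|M|\ge\rho|M^*|$, $M^*$ a maximum matching. $\textsc{Ranking}(\sigma)$, for a permutation $\sigma$ of $B$, matches each arriving $A$-vertex (in the input's arrival order) to its unmatched neighbour $b$ of minimum $\sigma(b)$, leaving it unmatched if none exists. For $c:B\to\{1,2\}$, $\sigma_c$ is the unique permutation of $B$ with $\sigma_c(b_1)<\sigma_c(b_2)$ iff $c(b_1)<c(b_2)$, or $c(b_1)=c(b_2)$ and $b_1<b_2$. *)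

theory Defs
  imports Complex_Main "HOL-Combinatorics.Permutations"
begin

record mbm_input =
  num_A :: nat
  num_B :: nat
  edges :: "(nat \<times> nat) set"
  arrival_order :: "nat list"

definition mbm_instance :: "mbm_input \<Rightarrow> bool" where
  "mbm_instance I \<longleftrightarrow>
     edges I \<subseteq> {1..num_A I} \<times> {1..num_B I} \<and>
     distinct (arrival_order I) \<and> set (arrival_order I) = {1..num_A I}"

type_synonym arrival = "nat \<times> nat set"

definition arrivals :: "mbm_input \<Rightarrow> arrival list" where
  "arrivals I = map (\<lambda>a. (a, edges I `` {a})) (arrival_order I)"

text \<open>Edges are ordered pairs, so the two sides need not be disjoint as sets of numbers.\<close>

definition matching :: "(nat \<times> nat) set \<Rightarrow> (nat \<times> nat) set \<Rightarrow> bool" where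
  "matching E M \<longleftrightarrow> M \<subseteq> E \<and> inj_on fst M \<and> inj_on snd M"

definition maximum_matching :: "(nat \<times> nat) set \<Rightarrow> (nat \<times> nat) set \<Rightarrow> bool" where
  "maximum_matching E M \<longleftrightarrow> matching E M \<and> (\<forall>M'. matching E M' \<longrightarrow> card M' \<le> card M)"

text \<open>
  A deterministic online rule sees the earlier arrivals, the matching built so far and the
  current arrival, and answers with the partner of the arriving vertex, if any.  An algorithm
  with advice additionally knows the size of the offline side and the advice string from the
  start.  A rule may return an illegal partner; in that case the result of the run is
  not a matching of the graph, which is ruled out by the definition of competitiveness.
\<close>

type_synonym online_rule = "arrival list \<Rightarrow> (nat \<times> nat) set \<Rightarrow> arrival \<Rightarrow> nat option"
type_synonym advice_algorithm = "nat \<Rightarrow> bool list \<Rightarrow> online_rule"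
type_synonym advice_oracle = "mbm_input \<Rightarrow> bool list"

fun run_from :: "online_rule \<Rightarrow> arrival list \<Rightarrow> (nat \<times> nat) set \<Rightarrow> arrival list \<Rightarrow> (nat \<times> nat) set" where
  "run_from d past M [] = M"
| "run_from d past M (r # rs) =
     run_from d (past @ [r])
       (case d past M r of None \<Rightarrow> M | Some b \<Rightarrow> insert (fst r, b) M) rs"

definition run :: "online_rule \<Rightarrow> mbm_input \<Rightarrow> (nat \<times> nat) set" where
  "run d I = run_from d [] {} (arrivals I)"

definition run_with_advice :: "advice_algorithm \<Rightarrow> advice_oracle \<Rightarrow> mbm_input \<Rightarrow> (nat \<times> nat) set" where
  "run_with_advice alg orc I = run (alg (num_B I) (orc I)) I"

definition competitive_with_advice :: "real \<Rightarrow> advice_algorithm \<Rightarrow> advice_oracle \<Rightarrow> bool" where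
  "competitive_with_advice \<rho> alg orc \<longleftrightarrow>
     (\<forall>I. mbm_instance I \<longrightarrow>
        matching (edges I) (run_with_advice alg orc I) \<and>
        (\<forall>M_opt. maximum_matching (edges I) M_opt \<longrightarrow>
           real (card (run_with_advice alg orc I)) \<ge> \<rho> * real (card M_opt)))"

definition uses_advice_bits :: "advice_oracle \<Rightarrow> (mbm_input \<Rightarrow> nat) \<Rightarrow> bool" where
  "uses_advice_bits orc k \<longleftrightarrow> (\<forall>I. mbm_instance I \<longrightarrow> length (orc I) = k I)"

definition ranking :: "(nat \<Rightarrow> nat) \<Rightarrow> online_rule" where
  "ranking \<sigma> past M r =
     (let F = {b \<in> snd r. b \<notin> snd ` M} in
      if F = {} then None else Some (arg_min_on \<sigma> F))"

text \<open>The permutation $\sigma_c$ of \<open>{1..m}\<close>, extended by the identity outside.\<close>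

definition category_ranking :: "nat \<Rightarrow> (nat \<Rightarrow> nat) \<Rightarrow> (nat \<Rightarrow> nat)" where
  "category_ranking m c =
     (THE \<sigma>. \<sigma> permutes {1..m} \<and>
        (\<forall>b1 \<in> {1..m}. \<forall>b2 \<in> {1..m}.
           \<sigma> b1 < \<sigma> b2 \<longleftrightarrow> c b1 < c b2 \<or> (c b1 = c b2 \<and> b1 < b2)))"

lemma category_ranking_unique_exists:
  fixes c :: "nat \<Rightarrow> nat"
  shows "\<exists>!\<sigma>. \<sigma> permutes {1..m} \<and>
        (\<forall>b1 \<in> {1..m}. \<forall>b2 \<in> {1..m}.
           \<sigma> b1 < \<sigma> b2 \<longleftrightarrow> c b1 < c b2 \<or> (c b1 = c b2 \<and> b1 < b2))"
    (is "\<exists>!\<sigma>. ?P \<sigma>")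
proof (rule ex_ex1I)
  define L where "L b1 b2 \<longleftrightarrow> c b1 < c b2 \<or> (c b1 = c b2 \<and> b1 < b2)" for b1 b2
  define S where "S b = {b' \<in> {1..m}. \<not> L b b'}" for b
  define f where "f b = card (S b)" for b
  have fin: "finite (S b)" for b by (simp add: S_def)
  have less: "f b1 < f b2" if "L b1 b2" "b1 \<in> {1..m}" "b2 \<in> {1..m}" for b1 b2
    unfolding f_def
  proof (rule psubset_card_mono[OF fin])
    have "b2 \<in> S b2" "b2 \<notin> S b1" "S b1 \<subseteq> S b2"
      using that by (auto simp: S_def L_def)
    then show "S b1 \<subset> S b2" by auto
  qed
  have tot: "L b1 b2 \<or> L b2 b1 \<or> b1 = b2" for b1 b2 by (auto simp: L_def)
  have iff: "f b1 < f b2 \<longleftrightarrow> L b1 b2" if "b1 \<in> {1..m}" "b2 \<in> {1..m}" for b1 b2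
    using less[of b1 b2] less[of b2 b1] tot[of b1 b2] that by auto
  have inj: "inj_on f {1..m}"
    by (rule inj_onI) (metis iff less_irrefl tot)
  have sub: "f ` {1..m} \<subseteq> {1..m}"
  proof
    fix y assume "y \<in> f ` {1..m}"
    then obtain b where b: "b \<in> {1..m}" "y = card (S b)" by (auto simp: f_def)
    have "b \<in> S b" using b by (auto simp: S_def L_def)
    then have "card (S b) > 0" using fin card_gt_0_iff by blast
    moreover have "card (S b) \<le> card {1..m}" by (rule card_mono) (auto simp: S_def)
    ultimately show "y \<in> {1..m}" using b by auto
  qed
  have "bij_betw f {1..m} {1..m}"
    unfolding bij_betw_def using inj sub endo_inj_surj by blast
  then have "bij_betw (\<lambda>b. if b \<in> {1..m} then f b else b) {1..m} {1..m}"
    by (rule bij_betw_cong[THEN iffD1, rotated]) simp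
  then have "(\<lambda>b. if b \<in> {1..m} then f b else b) permutes {1..m}"
    by (rule bij_imp_permutes) auto
  then have "?P (\<lambda>b. if b \<in> {1..m} then f b else b)"
    using iff by (simp add: L_def)
  then show "\<exists>\<sigma>. ?P \<sigma>" by blast
next
  have pos: "\<sigma> b = card {b' \<in> {1..m}. \<not> \<sigma> b < \<sigma> b'}"
    if "\<sigma> permutes {1..m}" "b \<in> {1..m}" for \<sigma> :: "nat \<Rightarrow> nat" and b
  proof -
    have im: "\<sigma> ` {1..m} = {1..m}" using that permutes_image by blast
    have "\<sigma> b \<in> {1..m}" using im that by blast
    then have "\<sigma> ` {b' \<in> {1..m}. \<not> \<sigma> b < \<sigma> b'} = {1..\<sigma> b}"
      using im by (fastforce simp: image_iff set_eq_iff)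
    moreover have "inj_on \<sigma> {b' \<in> {1..m}. \<not> \<sigma> b < \<sigma> b'}"
      using permutes_inj_on[OF that(1)] .
    ultimately show ?thesis by (metis card_image card_atLeastAtMost diff_Suc_1)
  qed
  fix \<sigma> \<tau> assume P: "?P \<sigma>" "?P \<tau>"
  show "\<sigma> = \<tau>"
  proof
    fix b
    show "\<sigma> b = \<tau> b"
    proof (cases "b \<in> {1..m}")
      case True
      have "{b' \<in> {1..m}. \<not> \<sigma> b < \<sigma> b'} = {b' \<in> {1..m}. \<not> \<tau> b < \<tau> b'}"
        using P True by blast
      then show ?thesis using pos[of \<sigma> b] pos[of \<tau> b] P True by simp
    next
      case False
      then show ?thesis using P by (simp add: permutes_def)
    qed
  qed
qed

text \<open>Bit number \<open>b - 1\<close> of the advice is set iff vertex \<open>b\<close> has category 2.\<close>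

definition encode_categories :: "nat \<Rightarrow> (nat \<Rightarrow> nat) \<Rightarrow> bool list" where
  "encode_categories m c = map (\<lambda>b. c b = 2) [1..<Suc m]"

definition decode_categories :: "bool list \<Rightarrow> nat \<Rightarrow> nat" where
  "decode_categories bs b = (if bs ! (b - 1) then 2 else 1)"

lemma decode_encode_categories:
  assumes "b \<in> {1..m}" "c b \<in> {1, 2}"
  shows "decode_categories (encode_categories m c) b = c b"
  using assms by (auto simp: decode_categories_def encode_categories_def nth_append simp del: upt_Suc)

definition greedy_category :: "mbm_input \<Rightarrow> nat \<Rightarrow> nat" where
  "greedy_category I b = (if b \<notin> snd ` run (ranking id) I then 1 else 2)"

definition category_oracle :: advice_oracle where
  "category_oracle I = encode_categories (num_B I) (greedy_category I)"

definition category_algorithm :: advice_algorithm where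
  "category_algorithm m bs = ranking (category_ranking m (decode_categories bs))"

lemma run_category_algorithm:
  "run_with_advice category_algorithm category_oracle I =
     run (ranking (category_ranking (num_B I) (greedy_category I))) I"
proof -
  have "decode_categories (category_oracle I) b = greedy_category I b" if "b \<in> {1..num_B I}" for b
    unfolding category_oracle_def
    by (rule decode_encode_categories[OF that]) (simp add: greedy_category_def)
  then have "category_ranking (num_B I) (decode_categories (category_oracle I)) =
      category_ranking (num_B I) (greedy_category I)"
    unfolding category_ranking_def by (intro arg_cong[where f = The] ext conj_cong ball_cong refl) simp
  then show ?thesis by (simp add: run_with_advice_def category_algorithm_def)
qed

end

theory Submission
  imports Defs
begin

text \<open>
  Let \<open>M\<^sub>G\<close> be the oracle's matching, \<open>C\<close> the set of offline vertices it covers (category 2),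
  and \<open>M\<close> the output, with \<open>s\<close> edges into category 1 and \<open>t\<close> edges into category 2.  A matching is
  no larger than a vertex cover, and \<open>M\<close> yields two covers.  Since category 1 is preferred, \<open>M\<close>
  restricted to category 1 is maximal there, so the \<open>2 s\<close> endpoints of that restriction together
  with \<open>C\<close> form a cover.  At every moment the category-2 vertices taken by the algorithm have also
  been taken in the oracle's run; hence every online vertex matched by \<open>M\<^sub>G\<close> is matched by \<open>M\<close>, which
  gives \<open>|C| \<le> s + t\<close> and makes the first cover of size at most \<open>3 s + t\<close>.  An online vertex
  unmatched by \<open>M\<close> is unmatched in \<open>M\<^sub>G\<close> too, so all its neighbours lie in category 2 and are matched
  by \<open>M\<close>; thus the \<open>s + t\<close> online endpoints of \<open>M\<close> and its \<open>t\<close> category-2 endpoints form a cover as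
  well.  Adding the first bound to twice the second gives \<open>3 |M\<^sup>*| \<le> 5 (s + t)\<close>.
\<close>

section \<open>Matchings and vertex covers\<close>

definition vertex_cover :: "('a \<times> 'b) set \<Rightarrow> 'a set \<Rightarrow> 'b set \<Rightarrow> bool" where
  "vertex_cover E X Y \<longleftrightarrow> (\<forall>(a, b)\<in>E. a \<in> X \<or> b \<in> Y)"

lemma vertex_coverI:
  assumes "\<And>a b. (a, b) \<in> E \<Longrightarrow> b \<notin> Y \<Longrightarrow> a \<in> X"
  shows "vertex_cover E X Y"
  using assms unfolding vertex_cover_def by blast

lemma matching_card_le_vertex_cover:
  assumes M: "matching E M" and cover: "vertex_cover E X Y" and fin: "finite X" "finite Y"
  shows "card M \<le> card X + card Y"
proof -
  let ?MX = "{e \<in> M. fst e \<in> X}" and ?MY = "{e \<in> M. snd e \<in> Y}"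
  have "M = ?MX \<union> ?MY"
    using M cover by (fastforce simp: matching_def vertex_cover_def)
  then have "card M = card (?MX \<union> ?MY)" by (rule arg_cong)
  also have "\<dots> \<le> card ?MX + card ?MY" by (rule card_Un_le)
  also have "\<dots> \<le> card X + card Y"
    using M fin
    by (intro add_mono card_inj_on_le[of fst] card_inj_on_le[of snd])
      (auto simp: matching_def intro: inj_on_subset)
  finally show ?thesis .
qed

lemma matching_mono: "matching E M \<Longrightarrow> E \<subseteq> E' \<Longrightarrow> matching E' M"
  by (auto simp: matching_def)

lemma matching_insert:
  assumes "matching E M" "a \<notin> fst ` M" "b \<notin> snd ` M"
  shows "matching (insert (a, b) E) (insert (a, b) M)"
  using assms by (auto simp: matching_def)

lemma three_fifths_matching_bound:
  fixes M :: "(nat \<times> nat) set" and C :: "nat set"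
  assumes opt: "matching E M_opt"
    and fin: "finite M" "finite C"
    and card_C: "card C \<le> card M"
    and preferred_maximal:
      "vertex_cover (E - UNIV \<times> C) (fst ` (M - UNIV \<times> C)) (snd ` (M - UNIV \<times> C))"
    and cover: "vertex_cover E (fst ` M) (snd ` (M \<inter> UNIV \<times> C))"
  shows "3 * card M_opt \<le> 5 * card M"
proof -
  let ?M1 = "M - UNIV \<times> C" and ?M2 = "M \<inter> UNIV \<times> C"
  have card_split: "card M = card ?M1 + card ?M2"
    using card_Int_Diff[OF fin(1), of "UNIV \<times> C"] by simp
  have "vertex_cover E (fst ` ?M1) (snd ` ?M1 \<union> C)"
    using preferred_maximal unfolding vertex_cover_def by blast
  then have "card M_opt \<le> card (fst ` ?M1) + card (snd ` ?M1 \<union> C)"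
    using opt fin by (intro matching_card_le_vertex_cover) auto
  also have "\<dots> \<le> card ?M1 + (card ?M1 + card C)"
    using fin by (intro add_mono card_image_le order_trans[OF card_Un_le]) auto
  finally have preferred_bound: "card M_opt \<le> 3 * card ?M1 + card ?M2"
    using card_C card_split by linarith
  have "card M_opt \<le> card (fst ` M) + card (snd ` ?M2)"
    using opt cover fin by (intro matching_card_le_vertex_cover) auto
  also have "\<dots> \<le> card M + card ?M2"
    using fin by (intro add_mono card_image_le) auto
  finally have saturated_bound: "card M_opt \<le> card ?M1 + 2 * card ?M2"
    using card_split by linarith
  show ?thesis using preferred_bound saturated_bound card_split by linarith
qed


section \<open>Runs of Ranking\<close>

definition revealed_edges :: "arrival list \<Rightarrow> (nat \<times> nat) set" where
  "revealed_edges rs = (\<Union>(a, N)\<in>set rs. {a} \<times> N)"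

definition ranking_run :: "(nat \<Rightarrow> nat) \<Rightarrow> arrival list \<Rightarrow> (nat \<times> nat) set" where
  "ranking_run \<sigma> rs = run_from (ranking \<sigma>) [] {} rs"

lemma revealed_edges_Nil [simp]: "revealed_edges [] = {}"
  by (simp add: revealed_edges_def)

lemma revealed_edges_snoc [simp]:
  "revealed_edges (rs @ [r]) = revealed_edges rs \<union> {fst r} \<times> snd r"
  by (auto simp: revealed_edges_def)

lemma fst_revealed_edges_subset: "fst ` revealed_edges rs \<subseteq> fst ` set rs"
  by (force simp: revealed_edges_def)

lemma run_from_append:
  "run_from d past M (xs @ ys) = run_from d (past @ xs) (run_from d past M xs) ys"
  by (induction xs arbitrary: past M) auto

lemma ranking_run_Nil [simp]: "ranking_run \<sigma> [] = {}"
  by (simp add: ranking_run_def)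

lemma ranking_run_snoc_cases [case_names unmatched matched]:
  fixes \<sigma> :: "nat \<Rightarrow> nat"
  obtains "snd r \<subseteq> snd ` ranking_run \<sigma> rs" "ranking_run \<sigma> (rs @ [r]) = ranking_run \<sigma> rs"
  | b where "b \<in> snd r" "b \<notin> snd ` ranking_run \<sigma> rs"
      "\<And>b'. b' \<in> snd r \<Longrightarrow> b' \<notin> snd ` ranking_run \<sigma> rs \<Longrightarrow> \<sigma> b \<le> \<sigma> b'"
      "ranking_run \<sigma> (rs @ [r]) = insert (fst r, b) (ranking_run \<sigma> rs)"
proof -
  let ?M = "ranking_run \<sigma> rs"
  define F where "F = {b \<in> snd r. b \<notin> snd ` ?M}"
  have "ranking \<sigma> rs ?M r = (if F = {} then None else Some (arg_min_on \<sigma> F))"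
    by (simp only: ranking_def Let_def F_def)
  then have snoc: "ranking_run \<sigma> (rs @ [r]) =
      (if F = {} then ?M else insert (fst r, arg_min_on \<sigma> F) ?M)"
    by (simp add: ranking_run_def run_from_append)
  show thesis
  proof (cases "F = {}")
    case True
    then show thesis using that(1) snoc by (auto simp: F_def)
  next
    case False
    then have best: "arg_min_on \<sigma> F \<in> F" "\<And>b'. b' \<in> F \<Longrightarrow> \<sigma> (arg_min_on \<sigma> F) \<le> \<sigma> b'"
      unfolding arg_min_on_def using arg_min_nat_lemma[of "\<lambda>b. b \<in> F" _ \<sigma>] by auto
    show thesis
    proof (rule that(2))
      show "arg_min_on \<sigma> F \<in> snd r" "arg_min_on \<sigma> F \<notin> snd ` ?M" using best(1) by (auto simp: F_def)
      show "\<sigma> (arg_min_on \<sigma> F) \<le> \<sigma> b'" if "b' \<in> snd r" "b' \<notin> snd ` ?M" for b'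
        using that by (intro best(2)) (simp add: F_def)
      show "ranking_run \<sigma> (rs @ [r]) = insert (fst r, arg_min_on \<sigma> F) ?M"
        using snoc False by simp
    qed
  qed
qed

lemma ranking_run_snoc_superset: "ranking_run \<sigma> rs \<subseteq> ranking_run \<sigma> (rs @ [r])"
  by (cases r \<sigma> rs rule: ranking_run_snoc_cases) auto

lemma matching_ranking_run:
  assumes "distinct (map fst rs)"
  shows "matching (revealed_edges rs) (ranking_run \<sigma> rs)"
  using assms
proof (induction rs rule: rev_induct)
  case Nil
  then show ?case by (simp add: matching_def)
next
  case (snoc r rs)
  then have IH: "matching (revealed_edges rs) (ranking_run \<sigma> rs)" by simp
  show ?case
  proof (cases r \<sigma> rs rule: ranking_run_snoc_cases)
    case unmatched
    then show ?thesis using IH by (auto intro: matching_mono)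
  next
    case (matched b)
    have "ranking_run \<sigma> rs \<subseteq> revealed_edges rs" using IH by (simp add: matching_def)
    then have "fst ` ranking_run \<sigma> rs \<subseteq> fst ` set rs"
      using fst_revealed_edges_subset by (meson image_mono subset_trans)
    then have "fst r \<notin> fst ` ranking_run \<sigma> rs" using snoc.prems by auto
    then have "matching (insert (fst r, b) (revealed_edges rs)) (ranking_run \<sigma> (rs @ [r]))"
      using IH matched(2,4) by (simp add: matching_insert)
    then show ?thesis by (rule matching_mono) (use matched(1) in auto)
  qed
qed

definition rank_stable :: "(nat \<Rightarrow> nat) \<Rightarrow> (nat \<times> nat) set \<Rightarrow> (nat \<times> nat) set \<Rightarrow> bool" where
  "rank_stable \<sigma> E M \<longleftrightarrow>
     (\<forall>(a, b)\<in>E. b \<notin> snd ` M \<longrightarrow> (\<exists>b'. (a, b') \<in> M \<and> \<sigma> b' \<le> \<sigma> b))"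

lemma rank_stableE:
  assumes "rank_stable \<sigma> E M" "(a, b) \<in> E" "b \<notin> snd ` M"
  obtains b' where "(a, b') \<in> M" "\<sigma> b' \<le> \<sigma> b"
  using assms unfolding rank_stable_def by blast

lemma rank_stable_imp_vertex_cover: "rank_stable \<sigma> E M \<Longrightarrow> vertex_cover E (fst ` M) (snd ` M)"
  by (force simp: rank_stable_def vertex_cover_def)

lemma rank_stable_mono: "rank_stable \<sigma> E M \<Longrightarrow> M \<subseteq> M' \<Longrightarrow> rank_stable \<sigma> E M'"
  unfolding rank_stable_def by blast

lemma rank_stable_Un: "rank_stable \<sigma> E M \<Longrightarrow> rank_stable \<sigma> E' M \<Longrightarrow> rank_stable \<sigma> (E \<union> E') M"
  unfolding rank_stable_def by blast

lemma rank_stable_ranking_run: "rank_stable \<sigma> (revealed_edges rs) (ranking_run \<sigma> rs)"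
proof (induction rs rule: rev_induct)
  case Nil
  then show ?case by (simp add: rank_stable_def)
next
  case (snoc r rs)
  have "rank_stable \<sigma> ({fst r} \<times> snd r) (ranking_run \<sigma> (rs @ [r]))"
    by (cases r \<sigma> rs rule: ranking_run_snoc_cases) (auto simp: rank_stable_def)
  then show ?case
    using rank_stable_mono[OF snoc ranking_run_snoc_superset] by (simp add: rank_stable_Un)
qed

lemma ranking_run_snd_dominated:
  fixes \<sigma> \<tau> :: "nat \<Rightarrow> nat"
  assumes inj: "inj_on \<sigma> C"
    and mono: "\<And>b b'. b \<in> C \<Longrightarrow> b' \<in> C \<Longrightarrow> \<sigma> b < \<sigma> b' \<Longrightarrow> \<tau> b < \<tau> b'"
    and "snd ` ranking_run \<sigma> rs \<subseteq> C"
  shows "snd ` ranking_run \<tau> rs \<inter> C \<subseteq> snd ` ranking_run \<sigma> rs"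
  using assms(3)
proof (induction rs rule: rev_induct)
  case Nil
  then show ?case by simp
next
  case (snoc r rs)
  let ?S = "ranking_run \<sigma>" and ?T = "ranking_run \<tau>"
  have "snd ` ?S rs \<subseteq> C"
    using image_mono[OF ranking_run_snoc_superset] snoc.prems by (rule subset_trans)
  then have IH: "snd ` ?T rs \<inter> C \<subseteq> snd ` ?S rs" by (rule snoc.IH)
  show ?case
  proof (cases r \<tau> rs rule: ranking_run_snoc_cases)
    case unmatched
    show ?thesis
      unfolding unmatched(2) using IH image_mono[OF ranking_run_snoc_superset] by (rule subset_trans)
  next
    case \<tau>: (matched b')
    show ?thesis
    proof (cases r \<sigma> rs rule: ranking_run_snoc_cases)
      case unmatched
      then show ?thesis using IH \<tau>(1,4) by auto
    next
      case \<sigma>: (matched b)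
      have b_free: "b \<in> C" "b \<notin> snd ` ?T rs" using \<sigma>(2,4) snoc.prems IH by auto
      have "b' = b" if b'_free: "b' \<in> C" "b' \<notin> snd ` ?S rs"
      proof (rule inj_onD[OF inj])
        have "\<sigma> b \<le> \<sigma> b'" using \<sigma>(3) \<tau>(1) b'_free(2) by blast
        moreover have "\<tau> b' \<le> \<tau> b" using \<tau>(3) \<sigma>(1) b_free(2) by blast
        then have "\<not> \<sigma> b < \<sigma> b'" using mono[OF b_free(1) b'_free(1)] by linarith
        ultimately show "\<sigma> b' = \<sigma> b" by simp
      qed (use b_free b'_free in simp_all)
      then show ?thesis using IH \<sigma>(4) \<tau>(4) by auto
    qed
  qed
qed

lemma ranking_run_fst_dominated:
  fixes \<sigma> \<tau> :: "nat \<Rightarrow> nat"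
  assumes inj: "inj_on \<sigma> C"
    and mono: "\<And>b b'. b \<in> C \<Longrightarrow> b' \<in> C \<Longrightarrow> \<sigma> b < \<sigma> b' \<Longrightarrow> \<tau> b < \<tau> b'"
    and "snd ` ranking_run \<sigma> rs \<subseteq> C"
  shows "fst ` ranking_run \<sigma> rs \<subseteq> fst ` ranking_run \<tau> rs"
  using assms(3)
proof (induction rs rule: rev_induct)
  case Nil
  then show ?case by simp
next
  case (snoc r rs)
  let ?S = "ranking_run \<sigma>" and ?T = "ranking_run \<tau>"
  have sub: "snd ` ?S rs \<subseteq> C"
    using image_mono[OF ranking_run_snoc_superset] snoc.prems by (rule subset_trans)
  have dom: "snd ` ?T rs \<inter> C \<subseteq> snd ` ?S rs"
    by (rule ranking_run_snd_dominated[OF inj mono sub])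
  have "fst ` ?S rs \<subseteq> fst ` ?T rs" using sub by (rule snoc.IH)
  also have "\<dots> \<subseteq> fst ` ?T (rs @ [r])" by (rule image_mono[OF ranking_run_snoc_superset])
  finally have old: "fst ` ?S rs \<subseteq> fst ` ?T (rs @ [r])" .
  show ?case
  proof (cases r \<sigma> rs rule: ranking_run_snoc_cases)
    case unmatched
    then show ?thesis using old by simp
  next
    case (matched b)
    have "b \<notin> snd ` ?T rs" using matched(2,4) snoc.prems dom by auto
    then have "fst r \<in> fst ` ?T (rs @ [r])"
      using matched(1) by (cases r \<tau> rs rule: ranking_run_snoc_cases) auto
    then show ?thesis using old matched(4) by simp
  qed
qed


section \<open>Ranking on a complete input\<close>

lemma run_ranking: "run (ranking \<sigma>) I = ranking_run \<sigma> (arrivals I)"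
  by (simp add: run_def ranking_run_def)

lemma revealed_edges_arrivals: "mbm_instance I \<Longrightarrow> revealed_edges (arrivals I) = edges I"
  by (auto simp: revealed_edges_def arrivals_def mbm_instance_def)

lemma finite_edges: "mbm_instance I \<Longrightarrow> finite (edges I)"
  unfolding mbm_instance_def by (meson finite_SigmaI finite_atLeastAtMost finite_subset)

lemma matching_run_ranking:
  assumes "mbm_instance I"
  shows "matching (edges I) (run (ranking \<sigma>) I)"
proof -
  have "distinct (map fst (arrivals I))"
    using assms by (simp add: mbm_instance_def arrivals_def comp_def)
  then show ?thesis
    using matching_ranking_run revealed_edges_arrivals[OF assms] by (metis run_ranking)
qed

lemma finite_run_ranking: "mbm_instance I \<Longrightarrow> finite (run (ranking \<sigma>) I)"
  using matching_run_ranking finite_edges finite_subset unfolding matching_def by blast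

lemma snd_run_ranking_subset: "mbm_instance I \<Longrightarrow> snd ` run (ranking \<sigma>) I \<subseteq> {1..num_B I}"
  using matching_run_ranking[of I \<sigma>] by (fastforce simp: matching_def mbm_instance_def)

lemma rank_stable_run_ranking:
  "mbm_instance I \<Longrightarrow> rank_stable \<sigma> (edges I) (run (ranking \<sigma>) I)"
  using rank_stable_ranking_run revealed_edges_arrivals by (metis run_ranking)


section \<open>The two-category algorithm\<close>

abbreviation greedy_matching :: "mbm_input \<Rightarrow> (nat \<times> nat) set" where
  "greedy_matching I \<equiv> run (ranking id) I"

abbreviation greedy_category_ranking :: "mbm_input \<Rightarrow> nat \<Rightarrow> nat" where
  "greedy_category_ranking I \<equiv> category_ranking (num_B I) (greedy_category I)"

abbreviation category_matching :: "mbm_input \<Rightarrow> (nat \<times> nat) set" where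
  "category_matching I \<equiv> run (ranking (greedy_category_ranking I)) I"

lemma category_ranking_less_iff:
  assumes "b1 \<in> {1..m}" "b2 \<in> {1..m}"
  shows "category_ranking m c b1 < category_ranking m c b2 \<longleftrightarrow>
           c b1 < c b2 \<or> (c b1 = c b2 \<and> b1 < b2)"
  using theI'[OF category_ranking_unique_exists[of m c]] assms
  unfolding category_ranking_def by blast

lemma fst_greedy_matching_subset:
  assumes I: "mbm_instance I"
  shows "fst ` greedy_matching I \<subseteq> fst ` category_matching I"
proof -
  have "greedy_category_ranking I b < greedy_category_ranking I b'"
    if "b \<in> snd ` greedy_matching I" "b' \<in> snd ` greedy_matching I" "b < b'" for b b'
  proof -
    have "b \<in> {1..num_B I}" "b' \<in> {1..num_B I}"
      using that(1,2) snd_run_ranking_subset[OF I] by blast+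
    then show ?thesis using that by (simp add: category_ranking_less_iff greedy_category_def)
  qed
  then show ?thesis
    unfolding run_ranking
    by (intro ranking_run_fst_dominated[of id "snd ` ranking_run id (arrivals I)"]) auto
qed

lemma card_greedy_matching_le:
  assumes I: "mbm_instance I"
  shows "card (greedy_matching I) \<le> card (category_matching I)"
proof -
  have "card (greedy_matching I) = card (fst ` greedy_matching I)"
    using matching_run_ranking[OF I] by (simp add: matching_def card_image)
  also have "\<dots> \<le> card (fst ` category_matching I)"
    using fst_greedy_matching_subset[OF I] finite_run_ranking[OF I] by (intro card_mono) auto
  also have "\<dots> \<le> card (category_matching I)"
    using finite_run_ranking[OF I] by (rule card_image_le)
  finally show ?thesis .
qed

lemma category_one_vertex_cover:
  assumes I: "mbm_instance I"
  defines "C \<equiv> snd ` greedy_matching I" and "M \<equiv> category_matching I"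
  shows "vertex_cover (edges I - UNIV \<times> C) (fst ` (M - UNIV \<times> C)) (snd ` (M - UNIV \<times> C))"
proof (rule vertex_coverI)
  fix a b
  assume "(a, b) \<in> edges I - UNIV \<times> C" and "b \<notin> snd ` (M - UNIV \<times> C)"
  moreover have "snd ` (M - UNIV \<times> C) = snd ` M - C" by force
  ultimately have edge: "(a, b) \<in> edges I" and b_unmatched: "b \<notin> C" "b \<notin> snd ` M" by auto
  have "rank_stable (greedy_category_ranking I) (edges I) M"
    unfolding M_def by (rule rank_stable_run_ranking[OF I])
  then obtain b' where b': "(a, b') \<in> M"
      "greedy_category_ranking I b' \<le> greedy_category_ranking I b"
    using edge b_unmatched(2) by (rule rank_stableE)
  have "b \<in> {1..num_B I}" using I edge by (auto simp: mbm_instance_def)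
  moreover have "b' \<in> {1..num_B I}"
    using snd_run_ranking_subset[OF I] b'(1) unfolding M_def by (metis image_subset_iff snd_conv)
  ultimately have "\<not> greedy_category I b < greedy_category I b'"
    using b'(2) category_ranking_less_iff by (metis leD)
  then have "b' \<notin> C" using b_unmatched(1) by (simp add: C_def greedy_category_def split: if_splits)
  then show "a \<in> fst ` (M - UNIV \<times> C)" using b'(1) by force
qed

lemma category_matching_vertex_cover:
  assumes I: "mbm_instance I"
  defines "C \<equiv> snd ` greedy_matching I" and "M \<equiv> category_matching I"
  shows "vertex_cover (edges I) (fst ` M) (snd ` (M \<inter> UNIV \<times> C))"
proof -
  have "vertex_cover (edges I) (fst ` greedy_matching I) C"
    unfolding C_def by (rule rank_stable_imp_vertex_cover[OF rank_stable_run_ranking[OF I]])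
  moreover have "vertex_cover (edges I) (fst ` M) (snd ` M)"
    unfolding M_def by (rule rank_stable_imp_vertex_cover[OF rank_stable_run_ranking[OF I]])
  moreover have "fst ` greedy_matching I \<subseteq> fst ` M"
    unfolding M_def by (rule fst_greedy_matching_subset[OF I])
  moreover have "snd ` (M \<inter> UNIV \<times> C) = snd ` M \<inter> C" by force
  ultimately show ?thesis unfolding vertex_cover_def by blast
qed

lemma category_matching_three_fifths:
  assumes I: "mbm_instance I" and opt: "matching (edges I) M_opt"
  shows "3 * card M_opt \<le> 5 * card (category_matching I)"
proof (rule three_fifths_matching_bound[OF opt])
  show "card (snd ` greedy_matching I) \<le> card (category_matching I)"
    using card_image_le[OF finite_run_ranking[OF I]] card_greedy_matching_le[OF I]
    by (rule order_trans)
qed (use I in \<open>simp_all add: finite_run_ranking category_one_vertex_cover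
    category_matching_vertex_cover\<close>)

lemma length_category_oracle: "length (category_oracle I) = num_B I"
  by (simp add: category_oracle_def encode_categories_def del: upt_Suc)

theorem theorem19:
  "competitive_with_advice (3/5) category_algorithm category_oracle \<and>
   uses_advice_bits category_oracle num_B"
proof
  show "competitive_with_advice (3/5) category_algorithm category_oracle"
    unfolding competitive_with_advice_def run_category_algorithm
  proof (intro allI impI conjI)
    fix I M_opt
    assume I: "mbm_instance I"
    show "matching (edges I) (category_matching I)" by (rule matching_run_ranking[OF I])
    assume "maximum_matching (edges I) M_opt"
    then have "3 * card M_opt \<le> 5 * card (category_matching I)"
      using category_matching_three_fifths[OF I] by (simp add: maximum_matching_def)
    then show "3/5 * real (card M_opt) \<le> real (card (category_matching I))" by linarith
  qed
  show "uses_advice_bits category_oracle num_B"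
    by (simp add: uses_advice_bits_def length_category_oracle)
qed

end
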